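(* Let $1\le r\le n$, let $p=(p_1,\dots,p_n)$ be a size vector, let $A,B\subseteq S_p$ form a maximal pair of $r$-cross-intersecting families, and let $T$ be the set of coordinates that are relevant for $A$ or for $B$. Then $$|A|\le \frac{|S_p|}{\prod_{i\in T}(p_i-1)^{1-2/p_i}}\quad\text{and}\quad |B|\le \frac{|S_p|}{\prod_{i\in T}(p_i-1)^{1-2/p_i}}.$$
   Context: $[m]=\{1,\dots,m\}$. A size vector is a sequence of integers $p=(p_1,\dots,p_n)$ with $p_i\ge 2$ for all $i$; $S_p=[p_1]\times\cdots\times[p_n]$. Two vectors $x,y\in S_p$ are $r$-intersecting if $|\{i: x_i=y_i\}|\ge r$; families $A,B\subseteq S_p$ are $r$-cross-intersecting if every $x\in A$, $y\in B$ are $r$-intersecting. A pair $(A,B)$ of $r$-cross-intersecting families in $S_p$ is maximal if it maximizes $|A|\cdot|B|$ among all $r$-cross-intersecting pairs in $S_p$. A coordinate $i$ is irrelevant for $A\subseteq S_p$ if whenever two elements of $S_p$ differ only in coordinate $i$ and one lies in $A$, so does the other; otherwise $i$ is relevant for $A$. *)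

theory Defs
  imports "HOL-Analysis.Analysis" "HOL-Library.FuncSet"
begin

text \<open>Coordinates are indexed by 0..n-1; a size vector is p :: nat => nat with p i >= 2
  for i < n. The space S_p consists of functions x with x i in [p i] = {1..p i} for i < n,
  and x i = undefined outside (PiE).\<close>

definition S :: "nat \<Rightarrow> (nat \<Rightarrow> nat) \<Rightarrow> (nat \<Rightarrow> nat) set" where
  "S n p = PiE {..<n} (\<lambda>i. {1..p i})"

definition r_intersecting :: "nat \<Rightarrow> nat \<Rightarrow> (nat \<Rightarrow> nat) \<Rightarrow> (nat \<Rightarrow> nat) \<Rightarrow> bool" where
  "r_intersecting n r x y \<longleftrightarrow> card {i \<in> {..<n}. x i = y i} \<ge> r"

definition cross_intersecting ::
  "nat \<Rightarrow> nat \<Rightarrow> (nat \<Rightarrow> nat) set \<Rightarrow> (nat \<Rightarrow> nat) set \<Rightarrow> bool" where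
  "cross_intersecting n r A B \<longleftrightarrow> (\<forall>x\<in>A. \<forall>y\<in>B. r_intersecting n r x y)"

definition maximal_pair ::
  "nat \<Rightarrow> (nat \<Rightarrow> nat) \<Rightarrow> nat \<Rightarrow> (nat \<Rightarrow> nat) set \<Rightarrow> (nat \<Rightarrow> nat) set \<Rightarrow> bool" where
  "maximal_pair n p r A B \<longleftrightarrow>
     A \<subseteq> S n p \<and> B \<subseteq> S n p \<and> cross_intersecting n r A B \<and>
     (\<forall>A' B'. A' \<subseteq> S n p \<and> B' \<subseteq> S n p \<and> cross_intersecting n r A' B' \<longrightarrow>
        card A' * card B' \<le> card A * card B)"

definition relevant :: "nat \<Rightarrow> (nat \<Rightarrow> nat) \<Rightarrow> (nat \<Rightarrow> nat) set \<Rightarrow> nat \<Rightarrow> bool" where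
  "relevant n p A i \<longleftrightarrow> i < n \<and>
     (\<exists>x\<in>S n p. \<exists>y\<in>S n p. (\<forall>j. j \<noteq> i \<longrightarrow> x j = y j) \<and> x \<in> A \<and> y \<notin> A)"

end

theory Submission
  imports Defs
begin

text \<open>Fix a relevant coordinate \<open>i\<close>, and let \<open>\<alpha> l\<close>, \<open>\<beta> l\<close> be the proportions of \<open>A\<close>, \<open>B\<close> with
  \<open>i\<close>-th entry \<open>l\<close>. For \<open>l \<noteq> m\<close>, freeing coordinate \<open>i\<close> in the \<open>l\<close>-slice of \<open>A\<close> and in the
  \<open>m\<close>-slice of \<open>B\<close> yields a cross-intersecting pair, so maximality gives
  \<open>\<alpha> l * \<beta> m \<le> 1 / p\<^sub>i\<^sup>2\<close>. These inequalities force either a common value \<open>l\<close> with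
  \<open>\<alpha> l, \<beta> l \<ge> 1 - 1 / p\<^sub>i\<close>, or both distributions to be uniform. In the uniform case with
  \<open>p\<^sub>i \<ge> 3\<close>, maximality applied to unions of two slices shows that all slices agree, contradicting
  relevance. Hence each relevant coordinate has a popular value, and a bound on the entropy of a
  uniformly random element of \<open>A\<close>, which appears below as a weighted count of \<open>A\<close> inside the
  product space, gives the theorem.\<close>

section \<open>Two distributions with small mixed products\<close>

text \<open>The deficits \<open>c - f l\<close> are nonnegative and sum to zero.\<close>

lemma sum_le_bound_eq:
  fixes f :: "'a \<Rightarrow> real"
  assumes "finite L" "\<And>l. l \<in> L \<Longrightarrow> f l \<le> c" "sum f L = real (card L) * c" "l \<in> L"
  shows "f l = c"
proof -
  have "(\<Sum>l\<in>L. c - f l) = 0"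
    using assms(3) by (simp add: sum_subtractf)
  then have "\<forall>l\<in>L. c - f l = 0"
    using assms(1,2) by (subst (asm) sum_nonneg_eq_0_iff) auto
  then show ?thesis using assms(4) by simp
qed

text \<open>With \<open>z\<close> the smaller and \<open>w\<close> the larger of \<open>x\<close>
  and \<open>y\<close>, \<open>z * (1 - z) \<le> w * (1 - z) \<le> e * (1 - e)\<close>, which keeps
  \<open>z\<close> out of the open interval from \<open>e\<close> to \<open>1 - e\<close>.\<close>

lemma two_point_dichotomy:
  fixes x y e :: real
  assumes "0 < e" "e \<le> 1/2" "e \<le> x" "x \<le> 1" "y \<le> 1"
    and xy: "x * (1 - y) \<le> e * (1 - e)" and yx: "y * (1 - x) \<le> e * (1 - e)"
  shows "(1 - e \<le> x \<and> 1 - e \<le> y) \<or> (x = e \<and> y = e)"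
proof -
  have "e * (1 - y) \<le> x * (1 - y)"
    using assms by (intro mult_right_mono) auto
  then have "e * (1 - y) \<le> e * (1 - e)" using xy by linarith
  then have ey: "e \<le> y" using \<open>0 < e\<close> by simp
  have *: "1 - e \<le> z \<or> (z = e \<and> w = e)"
    if "e \<le> z" "z \<le> w" "w \<le> 1" and wz: "w * (1 - z) \<le> e * (1 - e)" for z w
  proof (rule disjCI)
    assume H: "\<not> (z = e \<and> w = e)"
    show "1 - e \<le> z"
    proof (rule ccontr)
      assume "\<not> 1 - e \<le> z"
      then have z: "z < 1 - e" by simp
      have "z * (1 - z) \<le> w * (1 - z)"
        using that by (intro mult_right_mono) auto
      then have "z * (1 - z) \<le> e * (1 - e)" using wz by linarith
      then have "(z - e) * (1 - e - z) \<le> 0" by (simp add: algebra_simps)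
      then have "z - e \<le> 0" using z by (simp add: mult_le_0_iff)
      then have ze: "z = e" using that by simp
      then have "w * (1 - e) \<le> e * (1 - e)" using wz by simp
      then have "w \<le> e" using assms(2) by simp
      then show False using H ze that by simp
    qed
  qed
  show ?thesis
    using *[of y x] *[of x y] assms ey by (cases "y \<le> x") auto
qed

text \<open>A value \<open>l\<close> maximising \<open>a\<close> has \<open>a l \<ge> 1 / p\<close>;
  summing the mixed bounds over \<open>m \<noteq> l\<close> puts \<open>a l\<close> and
  \<open>b l\<close> under \<open>two_point_dichotomy\<close> with \<open>e = 1 / p\<close>.\<close>

lemma distributions_dichotomy:
  fixes a b :: "'a \<Rightarrow> real"
  assumes "finite L" and card: "card L = p" and "2 \<le> p"
    and nonneg: "\<And>l. l \<in> L \<Longrightarrow> 0 \<le> a l" "\<And>l. l \<in> L \<Longrightarrow> 0 \<le> b l"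
    and sums: "sum a L = 1" "sum b L = 1"
    and mixed: "\<And>l m. l \<in> L \<Longrightarrow> m \<in> L \<Longrightarrow> l \<noteq> m \<Longrightarrow> a l * b m \<le> 1 / (real p)\<^sup>2"
  obtains (popular) l where "l \<in> L" "1 - 1 / real p \<le> a l" "1 - 1 / real p \<le> b l"
  | (uniform) "\<And>l. l \<in> L \<Longrightarrow> a l = 1 / real p" "\<And>l. l \<in> L \<Longrightarrow> b l = 1 / real p"
proof -
  define e where "e = 1 / real p"
  have e: "0 < e" "e \<le> 1/2" and pe: "real p * e = 1" and e2: "1 / (real p)\<^sup>2 = e * e"
    using \<open>2 \<le> p\<close> by (auto simp: e_def field_simps power2_eq_square)
  have "L \<noteq> {}" using card \<open>2 \<le> p\<close> by auto
  then obtain l where l: "l \<in> L" and amax: "\<And>m. m \<in> L \<Longrightarrow> a m \<le> a l"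
    using Max_in[of "a ` L"] Max_ge[of "a ` L"] \<open>finite L\<close> by fastforce
  have "1 \<le> real p * a l"
    using sum_bounded_above[of L a "a l"] amax sums card by simp
  then have ea: "e \<le> a l" using \<open>2 \<le> p\<close> by (simp add: e_def field_simps)
  have c: "card (L - {l}) = p - 1" using l card \<open>finite L\<close> by simp
  have scale: "real (p - 1) * (e * e) = e * (1 - e)"
    using pe \<open>2 \<le> p\<close> by (simp add: of_nat_diff algebra_simps)
  have rest: "sum a (L - {l}) = 1 - a l" "sum b (L - {l}) = 1 - b l"
    using sums l \<open>finite L\<close> by (simp_all add: sum_diff1)
  have le1: "a l \<le> 1" "b l \<le> 1"
    using rest nonneg sum_nonneg[of "L - {l}" a] sum_nonneg[of "L - {l}" b] by auto
  have "(\<Sum>m\<in>L-{l}. a l * b m) \<le> real (p - 1) * (e * e)"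
    using sum_bounded_above[of "L - {l}" "\<lambda>m. a l * b m" "e * e"] mixed l c e2 by auto
  then have ab: "a l * (1 - b l) \<le> e * (1 - e)"
    by (simp only: scale rest flip: sum_distrib_left)
  have "(\<Sum>m\<in>L-{l}. b l * a m) \<le> real (p - 1) * (e * e)"
    using sum_bounded_above[of "L - {l}" "\<lambda>m. b l * a m" "e * e"] mixed l c e2
    by (auto simp: mult.commute)
  then have ba: "b l * (1 - a l) \<le> e * (1 - e)"
    by (simp only: scale rest flip: sum_distrib_left)
  from two_point_dichotomy[OF e ea le1 ab ba] show ?thesis
  proof
    assume "1 - e \<le> a l \<and> 1 - e \<le> b l"
    then show ?thesis using popular l by (simp add: e_def)
  next
    assume eq: "a l = e \<and> b l = e"
    \<comment> \<open>All values of \<open>a\<close> and \<open>b\<close> are at most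
      \<open>e\<close>, while each distribution sums to \<open>1 = p * e\<close>, so every value
      equals \<open>e\<close>.\<close>
    have "b m \<le> e" if "m \<in> L" for m
    proof (cases "m = l")
      case False
      then have "e * b m \<le> e * e" using mixed[OF l that] eq e2 by auto
      then show ?thesis using e by simp
    qed (use eq in simp)
    then have "b m = e" if "m \<in> L" for m
      using sum_le_bound_eq[of L b e m] \<open>finite L\<close> sums card pe that by simp
    moreover have "a m = e" if "m \<in> L" for m
      using sum_le_bound_eq[of L a e m] amax eq \<open>finite L\<close> sums card pe that by simp
    ultimately show ?thesis using uniform by (simp add: e_def)
  qed
qed

section \<open>Popular values of relevant coordinates\<close>

text \<open>For \<open>i < n\<close> and \<open>l \<in> {1..p i}\<close> this is the slice
  \<open>x i = l\<close> of \<open>A\<close> with coordinate \<open>i\<close> set free. It stays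
  inside \<open>S n p\<close>, so it can compete with \<open>A\<close> in the maximality
  condition.\<close>

definition cyl ::
  "nat \<Rightarrow> (nat \<Rightarrow> nat) \<Rightarrow> nat \<Rightarrow> (nat \<Rightarrow> nat) set \<Rightarrow> nat \<Rightarrow> (nat \<Rightarrow> nat) set" where
  "cyl n p i A l = {x \<in> S n p. x(i := l) \<in> A}"

lemma finite_S: "finite (S n p)"
  by (simp add: S_def finite_PiE)

lemma card_S: "card (S n p) = (\<Prod>i<n. p i)"
  by (simp add: S_def card_PiE)

lemma S_coord: "x \<in> S n p \<Longrightarrow> i < n \<Longrightarrow> x i \<in> {1..p i}"
  by (auto simp: S_def PiE_iff)

lemma S_upd: "x \<in> S n p \<Longrightarrow> i < n \<Longrightarrow> l \<in> {1..p i} \<Longrightarrow> x(i := l) \<in> S n p"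
  by (auto simp: S_def PiE_iff extensional_def)

lemma cyl_subset: "cyl n p i A l \<subseteq> S n p"
  by (auto simp: cyl_def)

lemma card_cyl:
  assumes "A \<subseteq> S n p" "i < n" "l \<in> {1..p i}"
  shows "card (cyl n p i A l) = p i * card {x \<in> A. x i = l}"
proof -
  \<comment> \<open>The inverse map records \<open>x i\<close> before overwriting it with
    \<open>l\<close>.\<close>
  have "bij_betw (\<lambda>(k, x). x(i := k)) ({1..p i} \<times> {x \<in> A. x i = l}) (cyl n p i A l)"
  proof (rule bij_betw_byWitness[where f' = "\<lambda>x. (x i, x(i := l))"])
    show "(\<lambda>(k, x). x(i := k)) ` ({1..p i} \<times> {x \<in> A. x i = l}) \<subseteq> cyl n p i A l"
      using assms S_upd by (fastforce simp: cyl_def)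
    show "(\<lambda>x. (x i, x(i := l))) ` cyl n p i A l \<subseteq> {1..p i} \<times> {x \<in> A. x i = l}"
      using assms S_coord by (fastforce simp: cyl_def)
  qed auto
  from bij_betw_same_card[OF this] show ?thesis
    by (simp add: card_cartesian_product)
qed

lemma sum_card_slices:
  assumes "A \<subseteq> S n p" "i < n"
  shows "(\<Sum>l\<in>{1..p i}. card {x \<in> A. x i = l}) = card A"
proof -
  have "finite A" using assms(1) finite_S finite_subset by blast
  then have "card (\<Union>l\<in>{1..p i}. {x \<in> A. x i = l}) = (\<Sum>l\<in>{1..p i}. card {x \<in> A. x i = l})"
    by (intro card_UN_disjoint) auto
  moreover have "(\<Union>l\<in>{1..p i}. {x \<in> A. x i = l}) = A"
    using assms S_coord by fastforce
  ultimately show ?thesis by simp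
qed

text \<open>After the updates the vectors disagree at \<open>i\<close>, so their \<open>r\<close>
  agreements lie at other coordinates, which the updates leave untouched.\<close>

lemma cross_intersecting_cyl:
  assumes "cross_intersecting n r A B" "l \<noteq> m"
  shows "cross_intersecting n r (cyl n p i A l) (cyl n p i B m)"
  unfolding cross_intersecting_def
proof (intro ballI)
  fix x y assume "x \<in> cyl n p i A l" "y \<in> cyl n p i B m"
  then have "r_intersecting n r (x(i := l)) (y(i := m))"
    using assms(1) by (auto simp: cyl_def cross_intersecting_def)
  then have "r \<le> card {j \<in> {..<n}. (x(i := l)) j = (y(i := m)) j}"
    by (simp add: r_intersecting_def)
  also have "\<dots> \<le> card {j \<in> {..<n}. x j = y j}"
    using assms(2) by (intro card_mono) (auto split: if_splits)
  finally show "r_intersecting n r x y" by (simp add: r_intersecting_def)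
qed

lemma cross_intersecting_Un:
  "cross_intersecting n r (A \<union> A') B \<longleftrightarrow>
     cross_intersecting n r A B \<and> cross_intersecting n r A' B"
  by (auto simp: cross_intersecting_def)

lemma cross_intersecting_sym:
  "cross_intersecting n r A B \<longleftrightarrow> cross_intersecting n r B A"
proof -
  have "r_intersecting n r x y = r_intersecting n r y x" for x y
    by (simp add: r_intersecting_def eq_commute)
  then show ?thesis by (auto simp: cross_intersecting_def)
qed

lemma maximal_pair_sym: "maximal_pair n p r A B \<Longrightarrow> maximal_pair n p r B A"
  unfolding maximal_pair_def by (metis cross_intersecting_sym mult.commute)

lemma maximal_pairD:
  assumes "maximal_pair n p r A B" "A' \<subseteq> S n p" "B' \<subseteq> S n p" "cross_intersecting n r A' B'"
  shows "card A' * card B' \<le> card A * card B"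
  using assms by (auto simp: maximal_pair_def)

lemma maximal_pair_card_pos:
  assumes "r \<le> n" "\<forall>i<n. 1 \<le> p i" "maximal_pair n p r A B"
  shows "0 < card A" "0 < card B"
proof -
  \<comment> \<open>The restricted lambda makes \<open>z\<close> undefined outside
    \<open>{..<n}\<close>, as membership in \<open>PiE\<close> demands.\<close>
  define z where "z = (\<lambda>i\<in>{..<n}. 1::nat)"
  have "z \<in> S n p" using assms(2) by (auto simp: z_def S_def)
  moreover have "cross_intersecting n r {z} {z}"
    using assms(1) by (simp add: cross_intersecting_def r_intersecting_def)
  ultimately have "1 \<le> card A * card B"
    using maximal_pairD[OF assms(3), of "{z}" "{z}"] by simp
  then show "0 < card A" "0 < card B" by (auto intro: gr0I)
qed

text \<open>If \<open>x \<in> A\<close> and \<open>y \<notin> A\<close> differ only at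
  \<open>i\<close>, then \<open>y\<close> lies in the freed slice for \<open>x i\<close> but not in
  the one for \<open>y i\<close>.\<close>

lemma irrelevant_if_cyl_eq:
  assumes "\<And>l m. l \<in> {1..p i} \<Longrightarrow> m \<in> {1..p i} \<Longrightarrow> cyl n p i A l = cyl n p i A m"
  shows "\<not> relevant n p A i"
proof
  assume "relevant n p A i"
  then obtain x y where i: "i < n" and xy: "x \<in> S n p" "y \<in> S n p" "x \<in> A" "y \<notin> A"
    and eq: "\<forall>j. j \<noteq> i \<longrightarrow> x j = y j"
    by (auto simp: relevant_def)
  have "y(i := x i) = x" using eq by auto
  then have "y \<in> cyl n p i A (x i)" using xy by (simp add: cyl_def)
  then have "y \<in> cyl n p i A (y i)" using assms S_coord xy i by blast
  then show False using xy by (simp add: cyl_def)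
qed

text \<open>A third value \<open>k\<close> gives a freed slice of \<open>B\<close> of size
  \<open>card B\<close> that cross-intersects the union of the freed \<open>l\<close>- and
  \<open>m\<close>-slices of \<open>A\<close>. Maximality caps this union at \<open>card A\<close>,
  the size of each of the two, so they coincide.\<close>

lemma irrelevant_if_uniform:
  assumes max: "maximal_pair n p r A B" and pos: "0 < card A" "0 < card B"
    and i: "i < n" "3 \<le> p i"
    and unifA: "\<And>l. l \<in> {1..p i} \<Longrightarrow> p i * card {x \<in> A. x i = l} = card A"
    and unifB: "\<And>l. l \<in> {1..p i} \<Longrightarrow> p i * card {x \<in> B. x i = l} = card B"
  shows "\<not> relevant n p A i"
proof (rule irrelevant_if_cyl_eq)
  fix l m assume lm: "l \<in> {1..p i}" "m \<in> {1..p i}"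
  have sub: "A \<subseteq> S n p" "B \<subseteq> S n p" and cross: "cross_intersecting n r A B"
    using max by (auto simp: maximal_pair_def)
  have "card {l, m} < card {1..p i}"
    using i card_insert_le_m1[of 2 "{m}" l] by simp
  then obtain k where k: "k \<in> {1..p i}" "k \<noteq> l" "k \<noteq> m"
    by (metis card_mono finite.emptyI finite_insert insertCI leD subsetI)
  let ?U = "cyl n p i A l \<union> cyl n p i A m"
  have "card ?U * card (cyl n p i B k) \<le> card A * card B"
    using k cross by (intro maximal_pairD[OF max])
      (auto simp: cross_intersecting_Un cyl_subset intro!: cross_intersecting_cyl)
  then have U: "card ?U \<le> card A"
    using card_cyl[OF sub(2) i(1) k(1)] unifB[OF k(1)] pos by simp
  have fin: "finite ?U"
    using finite_S cyl_subset by (meson finite_Un finite_subset)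
  have "cyl n p i A l = ?U"
    using card_cyl[OF sub(1) i(1) lm(1)] unifA[OF lm(1)] U by (intro card_seteq fin) auto
  moreover have "cyl n p i A m = ?U"
    using card_cyl[OF sub(1) i(1) lm(2)] unifA[OF lm(2)] U by (intro card_seteq fin) auto
  ultimately show "cyl n p i A l = cyl n p i A m" by simp
qed

text \<open>The hypotheses are symmetric in the pair, so the conclusion for \<open>A\<close> also
  serves \<open>B\<close> after a swap.\<close>

lemma relevant_popular_value:
  assumes max: "maximal_pair n p r A B" and "r \<le> n" "\<forall>i<n. 2 \<le> p i"
    and rel: "relevant n p A i \<or> relevant n p B i"
  obtains l where "l \<in> {1..p i}" "(1 - 1 / real (p i)) * card A \<le> card {x \<in> A. x i = l}"
proof -
  have i: "i < n" "2 \<le> p i" using rel assms(3) by (auto simp: relevant_def)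
  have "\<forall>i<n. 1 \<le> p i" using assms(3) by fastforce
  note pos = maximal_pair_card_pos[OF assms(2) this max]
  have sub: "A \<subseteq> S n p" "B \<subseteq> S n p" and cross: "cross_intersecting n r A B"
    using max by (auto simp: maximal_pair_def)
  define a where "a = (\<lambda>l. real (card {x \<in> A. x i = l}) / card A)"
  define b where "b = (\<lambda>l. real (card {x \<in> B. x i = l}) / card B)"
  have sums: "sum a {1..p i} = 1" "sum b {1..p i} = 1"
    using sum_card_slices[OF sub(1) i(1)] sum_card_slices[OF sub(2) i(1)] pos
    by (simp_all add: a_def b_def flip: sum_divide_distrib of_nat_sum)
  have mixed: "a l * b m \<le> 1 / (real (p i))\<^sup>2"
    if "l \<in> {1..p i}" "m \<in> {1..p i}" "l \<noteq> m" for l m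
  proof -
    have "card (cyl n p i A l) * card (cyl n p i B m) \<le> card A * card B"
      by (intro maximal_pairD[OF max] cyl_subset cross_intersecting_cyl cross that)
    then have "real (p i * card {x \<in> A. x i = l} * (p i * card {x \<in> B. x i = m}))
                 \<le> real (card A * card B)"
      unfolding card_cyl[OF sub(1) i(1) that(1)] card_cyl[OF sub(2) i(1) that(2)]
      by (rule of_nat_mono)
    then show ?thesis
      using pos i by (simp add: a_def b_def field_simps power2_eq_square)
  qed
  have nonneg: "\<And>l. 0 \<le> a l" "\<And>l. 0 \<le> b l" by (simp_all add: a_def b_def)
  consider l where "l \<in> {1..p i}" "1 - 1 / real (p i) \<le> a l"
    | "\<And>l. l \<in> {1..p i} \<Longrightarrow> a l = 1 / real (p i)" "\<And>l. l \<in> {1..p i} \<Longrightarrow> b l = 1 / real (p i)"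
    by (rule distributions_dichotomy[of "{1..p i}" "p i" a b, OF _ _ i(2) nonneg sums mixed])
      auto
  then show ?thesis
  proof cases
    case 1
    then show ?thesis using that pos by (simp add: a_def field_simps)
  next
    case 2
    show ?thesis
    proof (cases "p i = 2")
      \<comment> \<open>Here \<open>1 / p i = 1 - 1 / p i\<close>, so in the uniform case every
        value is already popular.\<close>
      case True
      then show ?thesis using that[of 1] 2(1)[of 1] pos by (simp add: a_def field_simps)
    next
      case False
      then have p3: "3 \<le> p i" using i by simp
      have A: "p i * card {x \<in> A. x i = l} = card A" if "l \<in> {1..p i}" for l
      proof -
        have "real (p i * card {x \<in> A. x i = l}) = card A"
          using 2(1)[OF that] pos i by (simp add: a_def field_simps)
        then show ?thesis by linarith
      qed
      have B: "p i * card {x \<in> B. x i = l} = card B" if "l \<in> {1..p i}" for l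
      proof -
        have "real (p i * card {x \<in> B. x i = l}) = card B"
          using 2(2)[OF that] pos i by (simp add: b_def field_simps)
        then show ?thesis by linarith
      qed
      from rel irrelevant_if_uniform[OF max pos i(1) p3 A B]
        irrelevant_if_uniform[OF maximal_pair_sym[OF max] pos(2,1) i(1) p3 B A]
      show ?thesis by blast
    qed
  qed
qed

section \<open>The entropy bound\<close>

text \<open>In entropy terms, \<open>u i v / p i\<close> is the reference distribution of coordinate \<open>i\<close> against which
  Gibbs' inequality is applied; it is the extremal one, giving the popular value mass
  \<open>1 - 1 / p i\<close>.\<close>

lemma card_le_of_popular_values:
  assumes A: "A \<subseteq> S n p" and T: "T \<subseteq> {..<n}" and p: "\<And>i. i \<in> T \<Longrightarrow> 2 \<le> p i"
    and l: "\<And>i. i \<in> T \<Longrightarrow> l i \<in> {1..p i}"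
    and popular: "\<And>i. i \<in> T \<Longrightarrow> (1 - 1 / real (p i)) * card A \<le> card {x \<in> A. x i = l i}"
  shows "real (card A) \<le> real (card (S n p)) /
           (\<Prod>i\<in>T. (real (p i) - 1) powr (1 - 2 / real (p i)))"
proof -
  define u where "u = (\<lambda>i v. if i \<notin> T then 1
    else if v = l i then real (p i) - 1 else 1 / (real (p i) - 1))"
  define g where "g = (\<lambda>x::nat \<Rightarrow> nat. \<Sum>i\<in>T. ln (u i (x i)))"
  define M where "M = (\<Sum>i\<in>T. (1 - 2 / real (p i)) * ln (real (p i) - 1))"
  have finT: "finite T" using T finite_subset by blast
  have finA: "finite A" using A finite_S finite_subset by blast
  have upos: "0 < u i v" for i v
    using p[of i] by (auto simp: u_def)
  \<comment> \<open>The weights average to 1 in each coordinate, so the product weight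
    \<open>exp (g x)\<close> has total \<open>card (S n p)\<close> over the whole space.\<close>
  have usum: "(\<Sum>v\<in>{1..p i}. u i v) = real (p i)" for i
  proof (cases "i \<in> T")
    case True
    have "(\<Sum>v\<in>{1..p i}. u i v) = u i (l i) + (\<Sum>v\<in>{1..p i} - {l i}. u i v)"
      using l[OF True] by (subst sum.remove[of _ "l i"]) auto
    also have "(\<Sum>v\<in>{1..p i} - {l i}. u i v) = (\<Sum>v\<in>{1..p i} - {l i}. 1 / (real (p i) - 1))"
      using True by (intro sum.cong) (auto simp: u_def)
    also have "\<dots> = 1"
      using l[OF True] p[OF True] by (simp add: of_nat_diff)
    finally show ?thesis using True by (simp add: u_def)
  qed (simp add: u_def)
  have expg: "exp (g x) = (\<Prod>i<n. u i (x i))" for x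
  proof -
    have "exp (g x) = (\<Prod>i\<in>T. u i (x i))"
      unfolding g_def using finT upos by (simp add: exp_sum)
    also have "\<dots> = (\<Prod>i<n. u i (x i))"
      using T by (intro prod.mono_neutral_left) (auto simp: u_def)
    finally show ?thesis .
  qed
  \<comment> \<open>The logarithm is \<open>?L\<close> at the popular value and \<open>- ?L\<close>
    elsewhere. Since \<open>?L \<ge> 0\<close>, its mean over \<open>A\<close> is at least
    \<open>(2 * (1 - 1 / p i) - 1) * ?L\<close>.\<close>
  have coord: "card A * ((1 - 2 / real (p i)) * ln (real (p i) - 1)) \<le> (\<Sum>x\<in>A. ln (u i (x i)))"
    if "i \<in> T" for i
  proof -
    let ?L = "ln (real (p i) - 1)"
    have L: "0 \<le> ?L" using p[OF that] by simp
    have "ln (u i (x i)) = 2 * ?L * (if x i = l i then 1 else 0) - ?L" for x :: "nat \<Rightarrow> nat"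
      using that p[OF that] by (auto simp: u_def ln_div)
    then have "(\<Sum>x\<in>A. ln (u i (x i))) = 2 * ?L * card {x \<in> A. x i = l i} - card A * ?L"
      using finA by (simp add: sum_subtractf sum.If_cases Int_def flip: sum_distrib_left)
    also have "\<dots> \<ge> 2 * ?L * ((1 - 1 / real (p i)) * card A) - card A * ?L"
      using popular[OF that] L by (intro diff_right_mono mult_left_mono) auto
    finally show ?thesis by (simp add: algebra_simps)
  qed
  have "card A * M \<le> (\<Sum>i\<in>T. \<Sum>x\<in>A. ln (u i (x i)))"
    unfolding M_def sum_distrib_left by (intro sum_mono coord)
  also have "\<dots> = sum g A"
    unfolding g_def by (rule sum.swap)
  finally have avg: "card A * M \<le> sum g A" .
  \<comment> \<open>Jensen's inequality for \<open>exp\<close>, through its tangent at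
    \<open>M\<close>: \<open>avg\<close> says that the deviations \<open>g x - M\<close> have
    nonnegative sum over \<open>A\<close>.\<close>
  have "exp M * card A \<le> exp M * (\<Sum>x\<in>A. 1 + (g x - M))"
    using avg by (simp add: sum.distrib sum_subtractf)
  also have "\<dots> \<le> exp M * (\<Sum>x\<in>A. exp (g x - M))"
    by (intro mult_left_mono sum_mono exp_ge_add_one_self) auto
  also have "\<dots> = (\<Sum>x\<in>A. exp (g x))"
    by (simp add: sum_distrib_left exp_diff)
  also have "\<dots> \<le> (\<Sum>x\<in>S n p. exp (g x))"
    using A finite_S by (intro sum_mono2) auto
  also have "\<dots> = (\<Prod>i<n. \<Sum>v\<in>{1..p i}. u i v)"
    unfolding expg S_def by (subst prod_sum_PiE) auto
  also have "\<dots> = card (S n p)"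
    by (simp only: usum card_S of_nat_prod)
  finally have "exp M * card A \<le> card (S n p)" .
  moreover have "exp M = (\<Prod>i\<in>T. (real (p i) - 1) powr (1 - 2 / real (p i)))"
    unfolding M_def exp_sum[OF finT] using p by (intro prod.cong) (force simp: powr_def)+
  ultimately show ?thesis
    by (metis exp_gt_zero mult.commute pos_le_divide_eq)
qed

theorem theorem5:
  fixes n r :: nat and p :: "nat \<Rightarrow> nat" and A B :: "(nat \<Rightarrow> nat) set"
  assumes "1 \<le> r" and "r \<le> n"
    and "\<forall>i<n. p i \<ge> 2"
    and "maximal_pair n p r A B"
  defines "T \<equiv> {i. relevant n p A i \<or> relevant n p B i}"
  shows "real (card A) \<le> real (card (S n p)) /
            (\<Prod>i\<in>T. (real (p i) - 1) powr (1 - 2 / real (p i))) \<and>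
         real (card B) \<le> real (card (S n p)) /
            (\<Prod>i\<in>T. (real (p i) - 1) powr (1 - 2 / real (p i)))"
proof -
  have T: "T \<subseteq> {..<n}" by (auto simp: T_def relevant_def)
  \<comment> \<open>Stated for a generic pair \<open>C\<close>, \<open>D\<close> with the same set
    \<open>T\<close>, so that it covers both orders of \<open>A\<close> and
    \<open>B\<close>.\<close>
  have bound: "real (card C) \<le> real (card (S n p)) /
            (\<Prod>i\<in>T. (real (p i) - 1) powr (1 - 2 / real (p i)))"
    if max: "maximal_pair n p r C D" and TCD: "T = {i. relevant n p C i \<or> relevant n p D i}" for C D
  proof -
    have "\<exists>l. l \<in> {1..p i} \<and> (1 - 1 / real (p i)) * card C \<le> card {x \<in> C. x i = l}"
      if "i \<in> T" for i
      using relevant_popular_value[OF max assms(2,3)] TCD that by blast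
    \<comment> \<open>Moving \<open>i \<in> T\<close> under the existential lets
      \<open>choice\<close> produce a total function \<open>l\<close>.\<close>
    then have "\<forall>i. \<exists>l. i \<in> T \<longrightarrow>
        l \<in> {1..p i} \<and> (1 - 1 / real (p i)) * card C \<le> card {x \<in> C. x i = l}"
      by blast
    from choice[OF this] obtain l where "\<And>i. i \<in> T \<Longrightarrow> l i \<in> {1..p i}"
        "\<And>i. i \<in> T \<Longrightarrow> (1 - 1 / real (p i)) * card C \<le> card {x \<in> C. x i = l i}"
      by blast
    moreover have "C \<subseteq> S n p" using max by (simp add: maximal_pair_def)
    ultimately show ?thesis
      using card_le_of_popular_values[of C n p T l] T assms(3) by blast
  qed
  show ?thesis
  proof
    show "real (card A) \<le> real (card (S n p)) /
            (\<Prod>i\<in>T. (real (p i) - 1) powr (1 - 2 / real (p i)))"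
      by (rule bound[OF assms(4)]) (simp add: T_def)
    show "real (card B) \<le> real (card (S n p)) /
            (\<Prod>i\<in>T. (real (p i) - 1) powr (1 - 2 / real (p i)))"
      by (rule bound[OF maximal_pair_sym[OF assms(4)]]) (auto simp: T_def)
  qed
qed

end
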